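(* Let $A$ be a non-empty subset of $C(\Omega,\mathbb{C})$, $W$ a topological vector subspace of $C(\Omega,X)$, and $W_0$ a subset of $CV_0W$. Assume that $A$ is a multiplier of $W_0$ and is symmetric. Then, for $f\in CV_0W$, $f\in\overline{W_0}$ (closure in $CV_0W$) if and only if $f(t)\in\overline{W_0(t)}$ for every $t\in\Omega$.
   Context: $\Omega$ is a topological space (not assumed Hausdorff). $X$ is a locally convex topological vector space (not assumed Hausdorff) with a family of seminorms $\mathcal{A}$. $C(\Omega,X)$ is the space of continuous maps $\Omega\to X$. For a map $f$ on $\Omega$, $\operatorname{supp} f$ is the closure of $\{x:f(x)\ne0\}$. $V$ is a Nachbin family, i.e. a set of upper semicontinuous functions $\Omega\to\mathbb{R}_+=[0,\infty)$, called weights. For $W\subset C(\Omega,X)$, the weighted space $CV_0W$ is the set of $f\in W$ such that for all $v\in V$, $p\in\mathcal{A}$, $\epsilon>0$ the set $\{x\in\Omega:v(x)p(f(x))\ge\epsilon\}$ is compact. Put $|f|_{v,p}=\sup_{x\in\Omega}v(x)p(f(x))$. The topology of $CV_0W$ is the one with local base at $0$ given by the sets $\{f\in CV_0W:|f|_{v,p}<\epsilon\}$, $v\in V$, $p\in\mathcal{A}$, $\epsilon>0$. For $t\in\Omega$, $W_0(t)=\{g(t):g\in W_0\}$, with closure taken in $X$. Multiplier: $\varphi\in C(\Omega,\mathbb{C})$ is a multiplier of $W_0\subset C(\Omega,X)$ if $\varphi f+(1-\varphi)g\in W_0$ for all $f,g\in W_0$; a set $A\subset C(\Omega,\mathbb{C})$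 is a multiplier of $W_0$ if every $\varphi\in A$ is. A subset $S\subset\Omega$ is $A$-antisymmetric if every $h\in A$ with $h(S)\subset[0,1]$ is constant on $S$; for $v\in V$, a subset $S\subset\operatorname{supp} v$ is $(A,v)$-antisymmetric if every $h\in A$ with $h(S)\subset[0,1]$ is constant on $S$. A non-empty $A\subset C(\Omega,\mathbb{C})$ is symmetric if every maximal $A$-antisymmetric set (or $(A,v)$-antisymmetric set) reduces to a point.
   Formalization: The formal theorem adds that for every t in Ω some weight v in V has v(t)>0 (and Ω is non-empty); without it "only if" fails: Ω a point, V={0}, X=ℂ, A=C(Ω,ℂ), W_0={0}, f=1. *)

theory Defs
  imports "HOL-Analysis.Analysis" "HOL-Library.Function_Algebras"
begin

text \<open>The locally convex space is the type \<open>'b\<close> with the complex scalar multiplication \<open>smul\<close>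
  and the topology given by a family \<open>P\<close> of seminorms; \<open>\<Omega>\<close> is the type \<open>'a\<close>, hence non-empty.\<close>

definition seminorm :: "(complex \<Rightarrow> 'b \<Rightarrow> 'b) \<Rightarrow> ('b::ab_group_add \<Rightarrow> real) \<Rightarrow> bool" where
  "seminorm smul p \<longleftrightarrow>
     (\<forall>x. 0 \<le> p x) \<and> (\<forall>x y. p (x + y) \<le> p x + p y) \<and> (\<forall>c x. p (smul c x) = cmod c * p x)"

text \<open>\<open>UNIV\<close> is inserted so that the topology has carrier \<open>UNIV\<close> even for \<open>P = {}\<close>.\<close>

definition seminorm_topology :: "('b::ab_group_add \<Rightarrow> real) set \<Rightarrow> 'b topology" where
  "seminorm_topology P = topology_generated_by
     (insert UNIV {{y. p (y - x) < \<epsilon>} | x p \<epsilon>. p \<in> P \<and> 0 < \<epsilon>})"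

definition continuous_maps ::
    "('b::ab_group_add \<Rightarrow> real) set \<Rightarrow> ('a::topological_space \<Rightarrow> 'b) set" where
  "continuous_maps P = {f. continuous_map euclidean (seminorm_topology P) f}"

definition support :: "('a::topological_space \<Rightarrow> 'b::zero) \<Rightarrow> 'a set" where
  "support f = closure {x. f x \<noteq> 0}"

definition upper_semicontinuous :: "('a::topological_space \<Rightarrow> real) \<Rightarrow> bool" where
  "upper_semicontinuous v \<longleftrightarrow> (\<forall>c. open {x. v x < c})"

definition nachbin_family :: "('a::topological_space \<Rightarrow> real) set \<Rightarrow> bool" where
  "nachbin_family V \<longleftrightarrow> (\<forall>v\<in>V. upper_semicontinuous v \<and> (\<forall>x. 0 \<le> v x))"

definition CV0 :: "('a::topological_space \<Rightarrow> real) set \<Rightarrow> ('b \<Rightarrow> real) set \<Rightarrow>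
    ('a \<Rightarrow> 'b) set \<Rightarrow> ('a \<Rightarrow> 'b) set" where
  "CV0 V P W = {f \<in> W. \<forall>v\<in>V. \<forall>p\<in>P. \<forall>\<epsilon>>0. compact {x. v x * p (f x) \<ge> \<epsilon>}}"

text \<open>A real supremum: for \<open>f\<close> in \<open>CV0 V P W\<close> the function is bounded, being upper semicontinuous
  with compact superlevel sets.\<close>

definition weighted_seminorm :: "('a \<Rightarrow> real) \<Rightarrow> ('b \<Rightarrow> real) \<Rightarrow> ('a \<Rightarrow> 'b) \<Rightarrow> real" where
  "weighted_seminorm v p f = (SUP x. v x * p (f x))"

definition weighted_ball :: "('a::topological_space \<Rightarrow> real) set \<Rightarrow>
    ('b::ab_group_add \<Rightarrow> real) set \<Rightarrow> ('a \<Rightarrow> 'b) set \<Rightarrow>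
    ('a \<Rightarrow> real) \<Rightarrow> ('b \<Rightarrow> real) \<Rightarrow> real \<Rightarrow> ('a \<Rightarrow> 'b) \<Rightarrow> ('a \<Rightarrow> 'b) set" where
  "weighted_ball V P W v p \<epsilon> f = {g \<in> CV0 V P W. weighted_seminorm v p (g - f) < \<epsilon>}"

text \<open>Generated by the translates of the sets \<open>{f. |f|\<^sub>v\<^sub>,\<^sub>p < \<epsilon>}\<close>. That these sets form a local
  base at \<open>0\<close>, and not merely a subbase, is a condition on the families \<open>V\<close> and \<open>P\<close>; it is
  expressed separately and holds, for instance, when both families are directed.\<close>

definition weighted_topology :: "('a::topological_space \<Rightarrow> real) set \<Rightarrow>
    ('b::ab_group_add \<Rightarrow> real) set \<Rightarrow> ('a \<Rightarrow> 'b) set \<Rightarrow> ('a \<Rightarrow> 'b) topology" where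
  "weighted_topology V P W = topology_generated_by
     (insert (CV0 V P W) {weighted_ball V P W v p \<epsilon> f | v p \<epsilon> f.
        v \<in> V \<and> p \<in> P \<and> 0 < \<epsilon> \<and> f \<in> CV0 V P W})"

definition balls_local_base_at_0 :: "('a::topological_space \<Rightarrow> real) set \<Rightarrow>
    ('b::ab_group_add \<Rightarrow> real) set \<Rightarrow> ('a \<Rightarrow> 'b) set \<Rightarrow> bool" where
  "balls_local_base_at_0 V P W \<longleftrightarrow>
     (\<forall>U. openin (weighted_topology V P W) U \<and> 0 \<in> U \<longrightarrow>
        (\<exists>v\<in>V. \<exists>p\<in>P. \<exists>\<epsilon>>0. weighted_ball V P W v p \<epsilon> 0 \<subseteq> U))"

definition multiplier :: "(complex \<Rightarrow> 'b \<Rightarrow> 'b) \<Rightarrow> ('a::topological_space \<Rightarrow> 'b::ab_group_add) set \<Rightarrow>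
    ('a \<Rightarrow> complex) \<Rightarrow> bool" where
  "multiplier smul W0 \<phi> \<longleftrightarrow> continuous_on UNIV \<phi> \<and>
     (\<forall>f\<in>W0. \<forall>g\<in>W0. (\<lambda>x. smul (\<phi> x) (f x) + smul (1 - \<phi> x) (g x)) \<in> W0)"

definition antisymmetric_set :: "('a \<Rightarrow> complex) set \<Rightarrow> 'a set \<Rightarrow> bool" where
  "antisymmetric_set A S \<longleftrightarrow>
     (\<forall>h\<in>A. h ` S \<subseteq> complex_of_real ` {0..1} \<longrightarrow> h constant_on S)"

definition weighted_antisymmetric_set ::
    "('a::topological_space \<Rightarrow> complex) set \<Rightarrow> ('a \<Rightarrow> real) \<Rightarrow> 'a set \<Rightarrow> bool" where
  "weighted_antisymmetric_set A v S \<longleftrightarrow> S \<subseteq> support v \<and> antisymmetric_set A S"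

text \<open>The empty set is disregarded: it is the only, hence a maximal, weighted antisymmetric set
  for \<open>v = 0\<close>.\<close>

definition maximal_sets_are_points :: "('a set \<Rightarrow> bool) \<Rightarrow> bool" where
  "maximal_sets_are_points Q \<longleftrightarrow>
     (\<forall>S. S \<noteq> {} \<and> Q S \<and> (\<forall>T. Q T \<and> S \<subseteq> T \<longrightarrow> T = S) \<longrightarrow> is_singleton S)"

text \<open>Both variants of the condition are admitted, the unweighted one and the one with respect to
  all weights in \<open>V\<close>.\<close>

definition symmetric :: "('a::topological_space \<Rightarrow> real) set \<Rightarrow> ('a \<Rightarrow> complex) set \<Rightarrow> bool" where
  "symmetric V A \<longleftrightarrow>
     maximal_sets_are_points (antisymmetric_set A) \<or>
     (\<forall>v\<in>V. maximal_sets_are_points (weighted_antisymmetric_set A v))"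

end

theory Submission
  imports Defs
begin

text \<open>Machado's argument. Fix \<open>v\<close>, \<open>p\<close> and \<open>d > 0\<close> such that no \<open>g \<in> W0\<close> satisfies
  \<open>v p(f - g) < d\<close> everywhere. Since the superlevel sets are compact, Zorn's lemma yields a minimal
  closed set \<open>S\<close> on which every \<open>g\<close> still fails. If some \<open>h \<in> A\<close> mapped \<open>S\<close> into \<open>[0,1]\<close> without
  being constant, two overlapping proper closed subsets of \<open>S\<close> given by \<open>Re h \<le> \<beta>\<close> and
  \<open>Re h \<ge> \<alpha>\<close>, with \<open>\<alpha> < \<beta>\<close>, would admit good approximations, and the multiplier
  \<open>(1 - h^n)^N\<close>, which is close to 1 for \<open>h \<le> \<alpha>\<close> and close to 0 for \<open>h \<ge> \<beta>\<close>, would glue them.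
  So \<open>S\<close> is antisymmetric, hence a point, where failure is excluded by assumption.\<close>

section \<open>Upper semicontinuous functions\<close>

text \<open>If no point of \<open>K\<close> were maximal, the open sets
  \<open>{y. e y < e x}\<close> with \<open>x \<in> K\<close> would cover \<open>K\<close>. In a
  finite subcover the index with the largest value of \<open>e\<close> is left uncovered.\<close>

lemma upper_semicontinuous_attains_max:
  assumes e: "upper_semicontinuous e" and K: "compact K" "K \<noteq> {}"
  obtains x where "x \<in> K" "\<And>y. y \<in> K \<Longrightarrow> e y \<le> e x"
proof (rule ccontr)
  assume "\<not> thesis"
  then have cover: "K \<subseteq> (\<Union>x\<in>K. {y. e y < e x})"
    using that by (force simp: not_le)
  have op: "\<And>x. x \<in> K \<Longrightarrow> open {y. e y < e x}"
    using e by (simp add: upper_semicontinuous_def)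
  obtain D where D: "D \<subseteq> K" "finite D" "K \<subseteq> (\<Union>x\<in>D. {y. e y < e x})"
    using compactE_image[OF K(1) op cover] by metis
  then have "D \<noteq> {}"
    using K(2) by auto
  then have "Max (e ` D) \<in> e ` D"
    using D(2) by simp
  then obtain x where x: "x \<in> D" "e x = Max (e ` D)"
    by auto
  then obtain z where "z \<in> D" "e x < e z"
    using D by blast
  then show False
    using x D(2) by (metis Max_ge finite_imageI imageI not_le)
qed

lemma upper_semicontinuous_bounded:
  assumes e: "upper_semicontinuous e" and K: "compact {x. 1 \<le> e x}"
  obtains B where "0 < B" "\<And>x. e x \<le> B"
proof (cases "{x. 1 \<le> e x} = {}")
  case True
  then have "e x \<le> 1" for x
    by (metis empty_Collect_eq linorder_le_cases)
  then show ?thesis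
    using that[of 1] by simp
next
  case False
  then obtain x where "1 \<le> e x" "\<And>y. 1 \<le> e y \<Longrightarrow> e y \<le> e x"
    using upper_semicontinuous_attains_max[OF e K] by auto
  then show ?thesis
    using that[of "e x"] by (meson less_le_trans linorder_le_cases order_trans zero_less_one)
qed

text \<open>Turns a pointwise strict bound on a closed set into a uniform gap: the part of
  \<open>T\<close> where \<open>e\<close> is at least \<open>d / 2\<close> is compact, so
  \<open>e\<close> attains its maximum there, and that maximum is below \<open>d\<close>.\<close>

lemma upper_semicontinuous_gap:
  assumes e: "upper_semicontinuous e" and d: "0 < d" and K: "compact {x. d / 2 \<le> e x}"
    and T: "closed T" "\<And>x. x \<in> T \<Longrightarrow> e x < d"
  obtains c where "c < d" "0 < c" "\<And>x. x \<in> T \<Longrightarrow> e x \<le> c"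
proof (cases "{x. d / 2 \<le> e x} \<inter> T = {}")
  case True
  then show ?thesis
    using that[of "d / 2"] d by force
next
  case False
  have "compact ({x. d / 2 \<le> e x} \<inter> T)"
    by (rule compact_Int_closed[OF K T(1)])
  then obtain x where x: "x \<in> {x. d / 2 \<le> e x} \<inter> T"
      "\<And>y. y \<in> {x. d / 2 \<le> e x} \<inter> T \<Longrightarrow> e y \<le> e x"
    using upper_semicontinuous_attains_max[OF e _ False] by blast
  have "e y \<le> e x" if "y \<in> T" for y
    using x that by (cases "d / 2 \<le> e y") auto
  then show ?thesis
    using that[of "e x"] x T(2) d by auto
qed

text \<open>Near \<open>a\<close> the factors stay below \<open>v a + r\<close> and
  \<open>q a + r\<close>. As both are nonnegative, their product stays below
  \<open>(v a + r) * (q a + r)\<close>, which is less than \<open>c\<close> for small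
  \<open>r > 0\<close>.\<close>

lemma upper_semicontinuous_mult:
  assumes v: "upper_semicontinuous v" "\<And>x. 0 \<le> v x"
    and q: "continuous_on UNIV q" "\<And>x. 0 \<le> q x"
  shows "upper_semicontinuous (\<lambda>x. v x * q x)"
  unfolding upper_semicontinuous_def
proof
  fix c
  show "open {x. v x * q x < c}"
  proof (subst open_subopen, intro ballI)
    fix a assume "a \<in> {x. v x * q x < c}"
    then have a: "v a * q a < c"
      by simp
    have "((\<lambda>r. (v a + r) * (q a + r)) \<longlongrightarrow> (v a + 0) * (q a + 0)) (at_right 0)"
      by (intro tendsto_intros)
    then have "\<forall>\<^sub>F r in at_right 0. (v a + r) * (q a + r) < c"
      using a by (intro order_tendstoD(2)) auto
    moreover have "\<forall>\<^sub>F r in at_right (0::real). 0 < r"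
      by (rule eventually_at_right_less)
    ultimately have "\<forall>\<^sub>F r in at_right 0. (v a + r) * (q a + r) < c \<and> 0 < r"
      by (rule eventually_conj)
    then obtain r where r: "(v a + r) * (q a + r) < c" "0 < r"
      by (metis (mono_tags, lifting) eventually_happens' trivial_limit_at_right_real)
    let ?T = "{x. v x < v a + r} \<inter> {x. q x < q a + r}"
    have "open ?T"
      using v(1) q(1) unfolding upper_semicontinuous_def
      by (intro open_Int open_Collect_less[of q] continuous_on_const) auto
    moreover have "?T \<subseteq> {x. v x * q x < c}"
    proof
      fix x assume "x \<in> ?T"
      then have "v x * q x \<le> (v a + r) * (q a + r)"
        using v(2)[of x] q(2)[of x] by (intro mult_mono) auto
      then show "x \<in> {x. v x * q x < c}"
        using r by auto
    qed
    ultimately show "\<exists>T. open T \<and> a \<in> T \<and> T \<subseteq> {x. v x * q x < c}"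
      using r(2) by (intro exI[of _ ?T]) auto
  qed
qed

section \<open>Minimal and maximal sets\<close>

text \<open>Intersecting a chain of closed sets preserves the condition because each superlevel set
  is compact: if the complements covered it, finitely many would, and in a chain one of these
  already would.\<close>

lemma minimal_closed_set:
  fixes E :: "('a::topological_space \<Rightarrow> real) set"
  assumes E: "\<And>e. e \<in> E \<Longrightarrow> compact {x. d \<le> e x}" "\<And>e. e \<in> E \<Longrightarrow> \<exists>x. d \<le> e x"
  obtains S where "closed S" "\<And>e. e \<in> E \<Longrightarrow> \<exists>x\<in>S. d \<le> e x"
    "\<And>T. closed T \<Longrightarrow> T \<subset> S \<Longrightarrow> \<exists>e\<in>E. \<forall>x\<in>T. e x < d"
proof -
  \<comment> \<open>Complements are used so that Zorn's lemma applies with unions as upper bounds; a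
    maximal open set gives a minimal closed one.\<close>
  define \<U> where "\<U> = {U. open U \<and> (\<forall>e\<in>E. \<exists>x. x \<notin> U \<and> d \<le> e x)}"
  have "{} \<in> \<U>"
    using E by (auto simp: \<U>_def)
  moreover have "\<Union>\<C> \<in> \<U>" if C: "\<C> \<noteq> {}" "subset.chain \<U> \<C>" for \<C>
  proof -
    have sub: "\<C> \<subseteq> \<U>"
      using C(2) by (simp add: subset.chain_def)
    then have op: "\<And>U. U \<in> \<C> \<Longrightarrow> open U"
      by (auto simp: \<U>_def)
    have "\<exists>x. x \<notin> \<Union>\<C> \<and> d \<le> e x" if e: "e \<in> E" for e
    proof (rule ccontr)
      assume "\<not> ?thesis"
      then have cover: "{x. d \<le> e x} \<subseteq> \<Union>\<C>"
        by blast
      obtain \<D> where D: "\<D> \<subseteq> \<C>" "finite \<D>" "{x. d \<le> e x} \<subseteq> \<Union>\<D>"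
        using compactE[OF E(1)[OF e] cover op] by metis
      have "\<D> \<noteq> {}"
        using D(3) E(2)[OF e] by auto
      moreover have "subset.chain \<U> \<D>"
        using C(2) D(1) unfolding subset.chain_def by (meson subset_iff)
      ultimately have "\<Union>\<D> \<in> \<D>"
        using Union_in_chain D(2) by blast
      then have "\<Union>\<D> \<in> \<U>"
        using D(1) sub by blast
      then show False
        using D(3) e unfolding \<U>_def mem_Collect_eq by (metis mem_Collect_eq subset_iff)
    qed
    then show ?thesis
      using op by (auto simp: \<U>_def)
  qed
  ultimately obtain M where M: "M \<in> \<U>" "\<forall>X\<in>\<U>. M \<subseteq> X \<longrightarrow> X = M"
    using subset_Zorn_nonempty[of \<U>] by blast
  show thesis
  proof (rule that)
    show "closed (- M)" "\<And>e. e \<in> E \<Longrightarrow> \<exists>x\<in>- M. d \<le> e x"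
      using M(1) by (auto simp: \<U>_def)
    fix T assume T: "closed T" "T \<subset> - M"
    then have "M \<subseteq> - T" "- T \<noteq> M"
      by auto
    then have "- T \<notin> \<U>"
      using M(2) by metis
    then show "\<exists>e\<in>E. \<forall>x\<in>T. e x < d"
      using T(1) by (auto simp: \<U>_def not_le)
  qed
qed

text \<open>Zorn's lemma enlarges \<open>S\<close> to a maximal antisymmetric set inside
  \<open>X\<close>, which is a point by hypothesis. The set \<open>X\<close> lets one argument serve
  both variants of symmetry.\<close>

lemma antisymmetric_set_singleton:
  assumes Q: "maximal_sets_are_points (\<lambda>S. S \<subseteq> X \<and> antisymmetric_set A S)"
    and S: "S \<subseteq> X" "antisymmetric_set A S" "S \<noteq> {}"
  shows "is_singleton S"
proof -
  define \<F> where "\<F> = {T. S \<subseteq> T \<and> T \<subseteq> X \<and> antisymmetric_set A T}"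
  obtain s where s: "s \<in> S"
    using S(3) by auto
  have "S \<in> \<F>"
    using S by (simp add: \<F>_def)
  moreover have "\<Union>\<C> \<in> \<F>" if C: "\<C> \<noteq> {}" "subset.chain \<F> \<C>" for \<C>
  proof -
    have sub: "\<C> \<subseteq> \<F>"
      using C(2) by (simp add: subset.chain_def)
    have "h constant_on \<Union>\<C>" if h: "h \<in> A" "h ` \<Union>\<C> \<subseteq> complex_of_real ` {0..1}" for h
      \<comment> \<open>The point \<open>s\<close> of \<open>S\<close> lies in every member of the
        chain, so the constant values on the members all agree with \<open>h s\<close>.\<close>
      unfolding constant_on_def
    proof (intro exI[of _ "h s"] ballI)
      fix x assume "x \<in> \<Union>\<C>"
      then obtain T where T: "T \<in> \<C>" "x \<in> T"
        by auto
      then have "antisymmetric_set A T" "s \<in> T"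
        using sub s by (auto simp: \<F>_def)
      moreover have "h ` T \<subseteq> complex_of_real ` {0..1}"
        using h(2) T(1) by blast
      ultimately show "h x = h s"
        using h(1) T(2) by (metis antisymmetric_set_def constant_on_def)
    qed
    then have "antisymmetric_set A (\<Union>\<C>)"
      by (auto simp: antisymmetric_set_def)
    then show ?thesis
      using C(1) sub by (auto simp: \<F>_def)
  qed
  ultimately obtain M where M: "M \<in> \<F>" "\<forall>T\<in>\<F>. M \<subseteq> T \<longrightarrow> T = M"
    using subset_Zorn_nonempty[of \<F>] by blast
  then have max: "M \<subseteq> X" "antisymmetric_set A M" "S \<subseteq> M"
      "\<And>T. T \<subseteq> X \<Longrightarrow> antisymmetric_set A T \<Longrightarrow> M \<subseteq> T \<Longrightarrow> T = M"
    unfolding \<F>_def by blast+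
  then have "M \<noteq> {}"
    using s by auto
  then have "is_singleton M"
    using Q max unfolding maximal_sets_are_points_def by metis
  then show ?thesis
    using max(3) s by (auto simp: is_singleton_def)
qed

lemma symmetric_antisymmetric_singleton:
  assumes "symmetric V A" "v \<in> V" "S \<subseteq> support v" "antisymmetric_set A S" "S \<noteq> {}"
  shows "is_singleton S"
  using assms(1) unfolding symmetric_def
proof
  assume "maximal_sets_are_points (antisymmetric_set A)"
  then show ?thesis
    using assms by (intro antisymmetric_set_singleton[of UNIV A S]) auto
next
  assume "\<forall>v\<in>V. maximal_sets_are_points (weighted_antisymmetric_set A v)"
  then have "maximal_sets_are_points (weighted_antisymmetric_set A v)"
    using assms(2) by blast
  then show ?thesis
    using assms unfolding weighted_antisymmetric_set_def
    by (intro antisymmetric_set_singleton[of "support v" A S]) (auto simp: weighted_antisymmetric_set_def[abs_def])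
qed

section \<open>Multipliers\<close>

text \<open>Bernoulli's inequality is applied twice. With \<open>N\<close> about
  \<open>1 / (\<beta> ^ n * \<delta>)\<close>, the product \<open>N * \<beta> ^ n\<close> is at
  least \<open>1 / \<delta>\<close>, while \<open>N * \<alpha> ^ n\<close> is small for large
  \<open>n\<close> because \<open>\<alpha> < \<beta>\<close>.\<close>

lemma power_bump:
  fixes \<alpha> \<beta> \<delta> :: real
  assumes "0 < \<alpha>" "\<alpha> < \<beta>" "\<beta> < 1" "0 < \<delta>"
  obtains n N :: nat where
    "\<And>t. 0 \<le> t \<Longrightarrow> t \<le> \<alpha> \<Longrightarrow> 1 - \<delta> \<le> (1 - t ^ n) ^ N"
    "\<And>t. \<beta> \<le> t \<Longrightarrow> t \<le> 1 \<Longrightarrow> (1 - t ^ n) ^ N \<le> \<delta>"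
proof -
  \<comment> \<open>This expression will bound \<open>N * \<alpha> ^ n\<close>; the summand
    \<open>\<alpha> ^ n\<close> pays for rounding \<open>N\<close> up to an integer.\<close>
  have "(\<lambda>n. (\<alpha> / \<beta>) ^ n / \<delta> + \<alpha> ^ n) \<longlonglongrightarrow> 0 / \<delta> + 0"
    using assms by (intro tendsto_intros LIMSEQ_realpow_zero) auto
  then have "\<forall>\<^sub>F n in sequentially. (\<alpha> / \<beta>) ^ n / \<delta> + \<alpha> ^ n < \<delta>"
    using assms(4) by (intro order_tendstoD(2)) auto
  then obtain n where n: "(\<alpha> / \<beta>) ^ n / \<delta> + \<alpha> ^ n < \<delta>"
    by (auto simp: eventually_sequentially)
  define N where "N = nat \<lceil>1 / (\<beta> ^ n * \<delta>)\<rceil>"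
  have pos: "0 < \<beta> ^ n * \<delta>" "0 < \<beta> ^ n"
    using assms by auto
  have N: "1 / (\<beta> ^ n * \<delta>) \<le> real N" "real N \<le> 1 / (\<beta> ^ n * \<delta>) + 1"
    unfolding N_def by (rule real_nat_ceiling_ge) (use pos in \<open>simp; linarith\<close>)
  show thesis
  proof (rule that)
    fix t :: real assume t: "0 \<le> t" "t \<le> \<alpha>"
    have "t ^ n \<le> \<alpha> ^ n"
      using t by (rule power_mono[rotated])
    then have "real N * t ^ n \<le> (1 / (\<beta> ^ n * \<delta>) + 1) * \<alpha> ^ n"
      using N t pos by (intro mult_mono) auto
    also have "\<dots> = (\<alpha> / \<beta>) ^ n / \<delta> + \<alpha> ^ n"
      by (simp add: power_divide field_simps)
    finally have "1 - \<delta> \<le> 1 + real N * (- (t ^ n))"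
      using n by simp
    also have "\<dots> \<le> (1 + - (t ^ n)) ^ N"
      using t assms by (intro Bernoulli_inequality) (simp add: power_le_one)
    finally show "1 - \<delta> \<le> (1 - t ^ n) ^ N"
      by simp
  next
    fix t :: real assume t: "\<beta> \<le> t" "t \<le> 1"
    have t0: "0 \<le> t ^ n" "t ^ n \<le> 1" "\<beta> ^ n \<le> t ^ n"
      using t assms by (auto intro: power_le_one power_mono)
    have "1 / \<delta> \<le> real N * \<beta> ^ n"
      using N(1) pos assms by (simp add: field_simps)
    also have "\<dots> \<le> real N * t ^ n"
      using t0 by (intro mult_left_mono) auto
    also have "\<dots> \<le> 1 + real N * t ^ n"
      by simp
    also have "\<dots> \<le> (1 + t ^ n) ^ N"
      using t0 by (intro Bernoulli_inequality) auto
    finally have "1 \<le> \<delta> * (1 + t ^ n) ^ N"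
      using assms(4) by (simp add: field_simps)
    \<comment> \<open>Bernoulli gives a lower bound for \<open>(1 + t ^ n) ^ N\<close>; it bounds
      \<open>(1 - t ^ n) ^ N\<close> from above because the product of the two bases is at most
      1.\<close>
    then have "(1 - t ^ n) ^ N * 1 \<le> (1 - t ^ n) ^ N * (\<delta> * (1 + t ^ n) ^ N)"
      using t0 by (intro mult_left_mono) auto
    also have "\<dots> = \<delta> * ((1 - t ^ n) * (1 + t ^ n)) ^ N"
      by (simp add: power_mult_distrib)
    also have "\<dots> = \<delta> * (1 - t ^ n * t ^ n) ^ N"
      by (simp add: algebra_simps)
    also have "\<dots> \<le> \<delta> * 1"
      using t0 assms(4) by (intro mult_left_mono power_le_one) (auto simp: mult_le_one)
    finally show "(1 - t ^ n) ^ N \<le> \<delta>"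
      by simp
  qed
qed

text \<open>Exchanging \<open>f\<close> and \<open>g\<close> exchanges the two coefficients.\<close>

lemma multiplier_diff:
  assumes "multiplier smul W0 \<phi>"
  shows "multiplier smul W0 (\<lambda>x. 1 - \<phi> x)"
  unfolding multiplier_def
proof (intro conjI ballI)
  show "continuous_on UNIV (\<lambda>x. 1 - \<phi> x)"
    using assms by (auto simp: multiplier_def intro!: continuous_intros)
  fix f g assume "f \<in> W0" "g \<in> W0"
  then have "(\<lambda>x. smul (\<phi> x) (g x) + smul (1 - \<phi> x) (f x)) \<in> W0"
    using assms by (simp add: multiplier_def)
  then show "(\<lambda>x. smul (1 - \<phi> x) (f x) + smul (1 - (1 - \<phi> x)) (g x)) \<in> W0"
    by (simp add: add.commute)
qed

text \<open>Combine \<open>f\<close> and \<open>g\<close> by \<open>\<psi>\<close>, then the result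
  and \<open>g\<close> by \<open>\<phi>\<close>: the total coefficient of \<open>f\<close> is the
  product.\<close>

lemma multiplier_mult:
  assumes "vector_space smul" "multiplier smul W0 \<phi>" "multiplier smul W0 \<psi>"
  shows "multiplier smul W0 (\<lambda>x. \<phi> x * \<psi> x)"
  unfolding multiplier_def
proof (intro conjI ballI)
  interpret vector_space smul by fact
  show "continuous_on UNIV (\<lambda>x. \<phi> x * \<psi> x)"
    using assms by (auto simp: multiplier_def intro!: continuous_intros)
  fix f g assume fg: "f \<in> W0" "g \<in> W0"
  then have "(\<lambda>x. smul (\<psi> x) (f x) + smul (1 - \<psi> x) (g x)) \<in> W0"
    using assms by (simp add: multiplier_def)
  then have "(\<lambda>x. smul (\<phi> x) (smul (\<psi> x) (f x) + smul (1 - \<psi> x) (g x))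
      + smul (1 - \<phi> x) (g x)) \<in> W0"
    using assms(2) fg by (simp add: multiplier_def)
  then show "(\<lambda>x. smul (\<phi> x * \<psi> x) (f x) + smul (1 - \<phi> x * \<psi> x) (g x)) \<in> W0"
    by (simp add: scale_right_distrib scale_left_diff_distrib scale_right_diff_distrib algebra_simps)
qed

lemma multiplier_power:
  assumes "vector_space smul" "multiplier smul W0 \<phi>"
  shows "multiplier smul W0 (\<lambda>x. \<phi> x ^ n)"
proof (induction n)
  case 0
  interpret vector_space smul by fact
  show ?case
    by (simp add: multiplier_def)
next
  case (Suc n)
  then show ?case
    using multiplier_mult[OF assms Suc] by simp
qed

section \<open>Weighted spaces\<close>

locale weighted_space = vector_space smul
  for smul :: "complex \<Rightarrow> 'b \<Rightarrow> 'b::ab_group_add" +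
  fixes P :: "('b \<Rightarrow> real) set" and V :: "('a::topological_space \<Rightarrow> real) set"
    and W :: "('a \<Rightarrow> 'b) set"
  assumes seminorms: "\<And>p. p \<in> P \<Longrightarrow> seminorm smul p"
    and nachbin: "nachbin_family V"
    and W_continuous: "W \<subseteq> continuous_maps P"
    and W_subspace: "module.subspace (\<lambda>c g t. smul c (g t)) W"
begin

context
  fixes p assumes p: "p \<in> P"
begin

lemma seminorm_nonneg: "0 \<le> p x"
  using seminorms[OF p] by (simp add: seminorm_def)

lemma seminorm_triangle: "p (x + y) \<le> p x + p y"
  using seminorms[OF p] by (simp add: seminorm_def)

lemma seminorm_scale: "p (smul c x) = cmod c * p x"
  using seminorms[OF p] by (simp add: seminorm_def)

lemma seminorm_0: "p 0 = 0"
  using seminorm_scale[of 0 0] by simp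

lemma seminorm_minus: "p (- x) = p x"
  using seminorm_scale[of "-1" x] by simp

lemma seminorm_diff_commute: "p (x - y) = p (y - x)"
  using seminorm_minus[of "x - y"] by simp

lemma seminorm_triangle_diff: "p (x - y) \<le> p x + p y"
  using seminorm_triangle[of x "- y"] seminorm_minus[of y] by simp

lemma seminorm_triangle_mid: "p (x - z) \<le> p (x - y) + p (y - z)"
  using seminorm_triangle[of "x - y" "y - z"] by simp

lemma openin_seminorm_ball:
  assumes "0 < \<epsilon>"
  shows "openin (seminorm_topology P) {y. p (y - x) < \<epsilon>}"
  unfolding seminorm_topology_def
  using assms p by (intro topology_generated_by_Basis) blast

text \<open>By the reverse triangle inequality \<open>p (g x)\<close> and \<open>p (g a)\<close>
  differ by at most \<open>p (g x - g a)\<close>, and this is small near \<open>a\<close> because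
  the seminorm ball about \<open>g a\<close> is open.\<close>

lemma continuous_on_seminorm:
  assumes "g \<in> W"
  shows "continuous_on UNIV (\<lambda>x. p (g x))"
proof -
  have g: "continuous_map euclidean (seminorm_topology P) g"
    using assms W_continuous by (auto simp: continuous_maps_def)
  have "(\<lambda>x. p (g x)) \<midarrow>a\<rightarrow> p (g a)" for a
  proof (rule tendstoI)
    fix \<epsilon> :: real assume "0 < \<epsilon>"
    then have "openin euclidean {x \<in> topspace euclidean. g x \<in> {y. p (y - g a) < \<epsilon>}}"
      by (intro openin_continuous_map_preimage[OF g] openin_seminorm_ball)
    then have "open {x. p (g x - g a) < \<epsilon>}"
      by simp
    moreover have "dist (p (g x)) (p (g a)) \<le> p (g x - g a)" for x
      using seminorm_triangle[of "g x - g a" "g a"] seminorm_triangle[of "g a - g x" "g x"]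
        seminorm_diff_commute[of "g a" "g x"]
      by (simp add: dist_real_def)
    ultimately show "\<forall>\<^sub>F x in at a. dist (p (g x)) (p (g a)) < \<epsilon>"
      using \<open>0 < \<epsilon>\<close> seminorm_0 unfolding eventually_at_topological
      by (intro exI[of _ "{x. p (g x - g a) < \<epsilon>}"]) (auto intro: le_less_trans)
  qed
  then show ?thesis
    by (simp add: continuous_on_def)
qed

lemma upper_semicontinuous_weighted:
  assumes "g \<in> W" "v \<in> V"
  shows "upper_semicontinuous (\<lambda>x. v x * p (g x))"
  using assms nachbin unfolding nachbin_family_def
  by (intro upper_semicontinuous_mult continuous_on_seminorm seminorm_nonneg) auto

end

lemma V_nonneg: "v \<in> V \<Longrightarrow> 0 \<le> v x"
  using nachbin by (simp add: nachbin_family_def)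

lemma W_closed:
  shows W_add: "f \<in> W \<Longrightarrow> g \<in> W \<Longrightarrow> f + g \<in> W" and W_0: "0 \<in> W"
    and W_diff: "f \<in> W \<Longrightarrow> g \<in> W \<Longrightarrow> f - g \<in> W"
proof -
  interpret F: module "\<lambda>c (g :: 'a \<Rightarrow> 'b) t. smul c (g t)"
    by unfold_locales (auto simp: fun_eq_iff scale_right_distrib scale_left_distrib)
  show "f \<in> W \<Longrightarrow> g \<in> W \<Longrightarrow> f + g \<in> W" "0 \<in> W" "f \<in> W \<Longrightarrow> g \<in> W \<Longrightarrow> f - g \<in> W"
    using W_subspace F.subspace_add F.subspace_0 F.subspace_diff by blast+
qed

lemma CV0_W: "f \<in> CV0 V P W \<Longrightarrow> f \<in> W"
  by (simp add: CV0_def)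

lemma CV0_compact:
  "f \<in> CV0 V P W \<Longrightarrow> v \<in> V \<Longrightarrow> p \<in> P \<Longrightarrow> 0 < \<epsilon> \<Longrightarrow> compact {x. \<epsilon> \<le> v x * p (f x)}"
  by (simp add: CV0_def)

lemma CV0_0: "0 \<in> CV0 V P W"
  using W_0 by (auto simp: CV0_def seminorm_0)

text \<open>Covers sums and differences at once. The superlevel set of \<open>h\<close> at
  \<open>\<epsilon>\<close> is closed by upper semicontinuity and lies in the union of those of
  \<open>f\<close> and \<open>g\<close> at \<open>\<epsilon> / 2\<close>, which is compact.\<close>

lemma CV0_combine:
  assumes f: "f \<in> CV0 V P W" and g: "g \<in> CV0 V P W" and h: "h \<in> W"
    and le: "\<And>p x. p \<in> P \<Longrightarrow> p (h x) \<le> p (f x) + p (g x)"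
  shows "h \<in> CV0 V P W"
  unfolding CV0_def
proof (intro CollectI conjI ballI allI impI h)
  fix v p and \<epsilon> :: real assume vp: "v \<in> V" "p \<in> P" and \<epsilon>: "0 < \<epsilon>"
  let ?K = "\<lambda>k. {x. \<epsilon> / 2 \<le> v x * p (k x)}"
  have "closed {x. \<epsilon> \<le> v x * p (h x)}"
    using upper_semicontinuous_weighted[OF vp(2) h vp(1)]
    by (simp add: upper_semicontinuous_def closed_def Collect_neg_eq[symmetric] not_le)
  moreover have "compact (?K f \<union> ?K g)"
    using f g vp \<epsilon> by (intro compact_Un CV0_compact) auto
  moreover have "{x. \<epsilon> \<le> v x * p (h x)} \<subseteq> ?K f \<union> ?K g"
  proof
    fix x assume "x \<in> {x. \<epsilon> \<le> v x * p (h x)}"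
    then have "\<epsilon> \<le> v x * p (f x) + v x * p (g x)"
      using mult_left_mono[OF le[OF vp(2), of x] V_nonneg[OF vp(1), of x]]
      by (simp add: distrib_left)
    then show "x \<in> ?K f \<union> ?K g"
      by auto
  qed
  ultimately show "compact {x. \<epsilon> \<le> v x * p (h x)}"
    using compact_Int_closed[of "?K f \<union> ?K g" "{x. \<epsilon> \<le> v x * p (h x)}"]
    by (simp only: Int_absorb1)
qed

lemma CV0_add: "f \<in> CV0 V P W \<Longrightarrow> g \<in> CV0 V P W \<Longrightarrow> f + g \<in> CV0 V P W"
  by (rule CV0_combine[of f g]) (simp_all add: W_add CV0_W seminorm_triangle)

lemma CV0_diff: "f \<in> CV0 V P W \<Longrightarrow> g \<in> CV0 V P W \<Longrightarrow> f - g \<in> CV0 V P W"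
  by (rule CV0_combine[of f g]) (simp_all add: W_diff CV0_W seminorm_triangle_diff)

lemma weighted_bounded:
  assumes "f \<in> CV0 V P W" "v \<in> V" "p \<in> P"
  obtains B where "0 < B" "\<And>x. v x * p (f x) \<le> B"
proof (rule upper_semicontinuous_bounded)
  show "upper_semicontinuous (\<lambda>x. v x * p (f x))"
    using assms by (intro upper_semicontinuous_weighted CV0_W)
  show "compact {x. 1 \<le> v x * p (f x)}"
    using assms by (intro CV0_compact) auto
qed (rule that)

text \<open>A real supremum dominates the values once they are bounded above, which membership in
  \<open>CV0\<close> guarantees.\<close>

lemma weighted_seminorm_upper:
  assumes "f \<in> CV0 V P W" "v \<in> V" "p \<in> P"
  shows "v x * p (f x) \<le> weighted_seminorm v p f"
proof -
  obtain B where "\<And>x. v x * p (f x) \<le> B"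
    using weighted_bounded[OF assms] by metis
  then have "bdd_above (range (\<lambda>x. v x * p (f x)))"
    by (intro bdd_aboveI2)
  then show ?thesis
    unfolding weighted_seminorm_def by (rule cSUP_upper[rotated]) simp
qed

section \<open>The topology of the weighted space: evaluations and translations\<close>

lemma topspace_weighted: "topspace (weighted_topology V P W) = CV0 V P W"
  by (auto simp: weighted_topology_def weighted_ball_def)

lemma openin_weighted_ball:
  assumes "v \<in> V" "p \<in> P" "0 < \<epsilon>" "f \<in> CV0 V P W"
  shows "openin (weighted_topology V P W) (weighted_ball V P W v p \<epsilon> f)"
  unfolding weighted_topology_def
  using assms by (intro topology_generated_by_Basis) blast

lemma weighted_ball_center:
  assumes "p \<in> P" "0 < \<epsilon>" "f \<in> CV0 V P W"
  shows "f \<in> weighted_ball V P W v p \<epsilon> f"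
  using assms by (simp add: weighted_ball_def weighted_seminorm_def seminorm_0)

text \<open>A weight that is positive at \<open>t\<close> can be divided out, so smallness in the
  weighted seminorm controls \<open>p\<close> of the value at \<open>t\<close>.\<close>

lemma continuous_map_evaluation:
  assumes pos: "\<exists>v\<in>V. 0 < v t"
  shows "continuous_map (weighted_topology V P W) (seminorm_topology P) (\<lambda>g. g t)"
  unfolding seminorm_topology_def continuous_on_generated_topo_iff topspace_weighted
proof (intro conjI allI impI)
  fix U assume "U \<in> insert UNIV {{y. p (y - x) < \<epsilon>} |x p \<epsilon>. p \<in> P \<and> 0 < \<epsilon>}"
  then consider "U = UNIV" | x p \<epsilon> where "U = {y. p (y - x) < \<epsilon>}" "p \<in> P" "0 < \<epsilon>"
    by blast
  then show "openin (weighted_topology V P W) ((\<lambda>g. g t) -` U \<inter> CV0 V P W)"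
  proof cases
    case 1
    then show ?thesis
      using openin_topspace[of "weighted_topology V P W"] by (simp add: topspace_weighted)
  next
    case (2 x p \<epsilon>)
    obtain v where v: "v \<in> V" "0 < v t"
      using pos by blast
    show ?thesis
    proof (subst openin_subopen, intro ballI)
      fix g assume g: "g \<in> (\<lambda>g. g t) -` U \<inter> CV0 V P W"
      \<comment> \<open>The room left around \<open>g t\<close> inside the ball about
        \<open>x\<close>, rescaled by the weight.\<close>
      define r where "r = v t * (\<epsilon> - p (g t - x))"
      have r: "0 < r"
        using g 2 v by (auto simp: r_def)
      have "weighted_ball V P W v p r g \<subseteq> (\<lambda>g. g t) -` U \<inter> CV0 V P W"
      proof
        fix k assume k: "k \<in> weighted_ball V P W v p r g"
        then have "k - g \<in> CV0 V P W"
          using g by (auto simp: weighted_ball_def intro: CV0_diff)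
        then have "v t * p ((k - g) t) < r"
          using weighted_seminorm_upper[of "k - g" v p t] k v(1) 2(2)
          by (simp add: weighted_ball_def)
        then have "p (k t - g t) < \<epsilon> - p (g t - x)"
          using v by (simp add: r_def)
        then show "k \<in> (\<lambda>g. g t) -` U \<inter> CV0 V P W"
          using k 2 seminorm_triangle_mid[OF 2(2), of "k t" x "g t"]
          by (simp add: weighted_ball_def)
      qed
      then show "\<exists>T. openin (weighted_topology V P W) T \<and> g \<in> T \<and>
          T \<subseteq> (\<lambda>g. g t) -` U \<inter> CV0 V P W"
        using openin_weighted_ball[OF v(1) 2(2) r, of g] weighted_ball_center[OF 2(2) r, of g v] g
        by blast
    qed
  qed
qed auto

text \<open>Preimages of generating balls are again generating balls, with the centre shifted by
  \<open>- f\<close>.\<close>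

lemma continuous_map_translation:
  assumes f: "f \<in> CV0 V P W"
  shows "continuous_map (weighted_topology V P W) (weighted_topology V P W) (\<lambda>g. g + f)"
proof -
  have "openin (weighted_topology V P W) ((\<lambda>g. g + f) -` U \<inter> CV0 V P W)"
    if "U = CV0 V P W \<or> (\<exists>v p \<epsilon> c. U = weighted_ball V P W v p \<epsilon> c \<and>
      v \<in> V \<and> p \<in> P \<and> 0 < \<epsilon> \<and> c \<in> CV0 V P W)" for U
    using that
  proof (elim disjE exE conjE)
    assume "U = CV0 V P W"
    then have "(\<lambda>g. g + f) -` U \<inter> CV0 V P W = topspace (weighted_topology V P W)"
      using f by (auto simp: topspace_weighted intro: CV0_add)
    then show ?thesis
      by simp
  next
    fix v p \<epsilon> c
    assume U: "U = weighted_ball V P W v p \<epsilon> c"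
      and c: "v \<in> V" "p \<in> P" "0 < (\<epsilon>::real)" "c \<in> CV0 V P W"
    have "(\<lambda>g. g + f) -` U \<inter> CV0 V P W = weighted_ball V P W v p \<epsilon> (c - f)"
      using f by (auto simp: U weighted_ball_def algebra_simps intro: CV0_add)
    then show ?thesis
      using openin_weighted_ball[OF c(1-3) CV0_diff[OF c(4) f]] by simp
  qed
  then show ?thesis
    \<comment> \<open>Only the topology of the codomain is unfolded, so continuity is tested on its
      generating sets.\<close>
    by (subst (2) weighted_topology_def, unfold continuous_on_generated_topo_iff topspace_weighted)
      (use f in \<open>auto intro: CV0_add\<close>)
qed

text \<open>The local base is given at 0 only; translation by \<open>f\<close> carries it to
  \<open>f\<close>.\<close>

lemma weighted_ball_neighbourhood:
  assumes base: "balls_local_base_at_0 V P W" and f: "f \<in> CV0 V P W"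
    and U: "openin (weighted_topology V P W) U" "f \<in> U"
  obtains v p \<epsilon> where "v \<in> V" "p \<in> P" "0 < \<epsilon>" "weighted_ball V P W v p \<epsilon> f \<subseteq> U"
proof -
  let ?U = "{g \<in> topspace (weighted_topology V P W). g + f \<in> U}"
  have "openin (weighted_topology V P W) ?U"
    by (rule openin_continuous_map_preimage[OF continuous_map_translation[OF f] U(1)])
  moreover have "0 \<in> ?U"
    using U(2) CV0_0 by (simp add: topspace_weighted)
  ultimately obtain v p \<epsilon> where vp: "v \<in> V" "p \<in> P" "0 < \<epsilon>" "weighted_ball V P W v p \<epsilon> 0 \<subseteq> ?U"
    using base unfolding balls_local_base_at_0_def by meson
  have "weighted_ball V P W v p \<epsilon> f \<subseteq> U"
  proof
    fix g assume "g \<in> weighted_ball V P W v p \<epsilon> f"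
    then have "g - f \<in> weighted_ball V P W v p \<epsilon> 0"
      using f by (simp add: weighted_ball_def CV0_diff)
    then show "g \<in> U"
      using vp(4) by auto
  qed
  then show thesis
    using that vp by blast
qed

section \<open>Approximation with respect to one weight and one seminorm\<close>

text \<open>On \<open>S\<close> the error of the glued function is at most a convex combination of
  the errors of \<open>g1\<close> and \<open>g2\<close>. Where both are good, any coefficients do;
  elsewhere the bad error is merely bounded, but its coefficient is at most
  \<open>\<delta>\<close>.\<close>

lemma separated_gluing:
  assumes W0: "W0 \<subseteq> CV0 V P W" and f: "f \<in> CV0 V P W" and vp: "v \<in> V" "p \<in> P"
    and d: "0 < d" and h: "multiplier smul W0 h" and S: "closed S" "h ` S \<subseteq> complex_of_real ` {0..1}"
    and ab: "0 < \<alpha>" "\<alpha> < \<beta>" "\<beta> < 1"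
    and g1: "g1 \<in> W0" "\<And>x. x \<in> S \<Longrightarrow> Re (h x) \<le> \<beta> \<Longrightarrow> v x * p (f x - g1 x) < d"
    and g2: "g2 \<in> W0" "\<And>x. x \<in> S \<Longrightarrow> \<alpha> \<le> Re (h x) \<Longrightarrow> v x * p (f x - g2 x) < d"
  shows "\<exists>g\<in>W0. \<forall>x\<in>S. v x * p (f x - g x) < d"
proof -
  have cont: "continuous_on UNIV (\<lambda>x. Re (h x))"
    using h by (auto simp: multiplier_def intro!: continuous_intros)
  define S1 where "S1 = S \<inter> {x. Re (h x) \<le> \<beta>}"
  define S2 where "S2 = S \<inter> {x. \<alpha> \<le> Re (h x)}"
  have S12: "closed S1" "closed S2"
    unfolding S1_def S2_def
    using S(1) cont by (auto intro!: closed_Int closed_Collect_le continuous_intros)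
  have D: "f - g1 \<in> CV0 V P W" "f - g2 \<in> CV0 V P W"
    using W0 g1(1) g2(1) f by (auto intro: CV0_diff)
  have usc: "upper_semicontinuous (\<lambda>x. v x * p ((f - g1) x))"
    "upper_semicontinuous (\<lambda>x. v x * p ((f - g2) x))"
    using upper_semicontinuous_weighted vp D CV0_W by blast+
  have K: "compact {x. d / 2 \<le> v x * p ((f - g1) x)}" "compact {x. d / 2 \<le> v x * p ((f - g2) x)}"
    using CV0_compact[OF D(1) vp, of "d / 2"] CV0_compact[OF D(2) vp, of "d / 2"] d by (simp_all only: half_gt_zero)
  obtain c1 where c1: "c1 < d" "0 < c1" "\<And>x. x \<in> S1 \<Longrightarrow> v x * p (f x - g1 x) \<le> c1"
    using upper_semicontinuous_gap[OF usc(1) d K(1) S12(1)] g1(2) by (auto simp: S1_def)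
  obtain c2 where c2: "c2 < d" "0 < c2" "\<And>x. x \<in> S2 \<Longrightarrow> v x * p (f x - g2 x) \<le> c2"
    using upper_semicontinuous_gap[OF usc(2) d K(2) S12(2)] g2(2) by (auto simp: S2_def)
  obtain B1 where B1: "0 < B1" "\<And>x. v x * p (f x - g1 x) \<le> B1"
    using weighted_bounded[OF D(1) vp] by auto
  obtain B2 where B2: "0 < B2" "\<And>x. v x * p (f x - g2 x) \<le> B2"
    using weighted_bounded[OF D(2) vp] by auto
  define c where "c = max c1 c2"
  define B where "B = max B1 B2"
  \<comment> \<open>Chosen so that \<open>c + \<delta> * B\<close> is the midpoint of
    \<open>c\<close> and \<open>d\<close>; here \<open>c\<close> bounds the good errors and
    \<open>B\<close> all errors.\<close>
  define \<delta> where "\<delta> = (d - c) / (2 * B)"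
  have cB: "c < d" "0 < c" "0 < B"
    using c1 c2 B1 B2 by (auto simp: c_def B_def)
  then have \<delta>: "0 < \<delta>" "c + \<delta> * B < d"
    by (auto simp: \<delta>_def field_simps)
  obtain n N where bump: "\<And>t. 0 \<le> t \<Longrightarrow> t \<le> \<alpha> \<Longrightarrow> 1 - \<delta> \<le> (1 - t ^ n) ^ N"
      "\<And>t. \<beta> \<le> t \<Longrightarrow> t \<le> 1 \<Longrightarrow> (1 - t ^ n) ^ N \<le> \<delta>"
    using power_bump[OF ab \<delta>(1)] by metis
  define \<phi> where "\<phi> = (\<lambda>x. (1 - h x ^ n) ^ N)"
  define g where "g = (\<lambda>x. smul (\<phi> x) (g1 x) + smul (1 - \<phi> x) (g2 x))"
  have "multiplier smul W0 \<phi>"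
    unfolding \<phi>_def by (intro multiplier_power multiplier_diff h vector_space_axioms)
  then have "g \<in> W0"
    using g1(1) g2(1) by (simp add: multiplier_def g_def)
  moreover have "v x * p (f x - g x) < d" if x: "x \<in> S" for x
  proof -
    obtain t where t: "h x = complex_of_real t" "0 \<le> t" "t \<le> 1"
    proof -
      have "h x \<in> complex_of_real ` {0..1}"
        using S(2) imageI[OF x] by (rule subsetD)
      then show thesis
        using that by auto
    qed
    define r where "r = (1 - t ^ n) ^ N"
    have r: "0 \<le> r" "r \<le> 1" "\<phi> x = complex_of_real r"
      using t by (auto simp: r_def \<phi>_def power_le_one)
    let ?e1 = "v x * p (f x - g1 x)" and ?e2 = "v x * p (f x - g2 x)"
    have "f x - g x = smul (\<phi> x) (f x - g1 x) + smul (1 - \<phi> x) (f x - g2 x)"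
      by (simp add: g_def scale_right_diff_distrib scale_left_diff_distrib)
    then have "p (f x - g x) \<le> cmod (\<phi> x) * p (f x - g1 x) + cmod (1 - \<phi> x) * p (f x - g2 x)"
      using seminorm_triangle[OF vp(2)] seminorm_scale[OF vp(2)] by metis
    also have "cmod (\<phi> x) = r"
      using r by simp
    also have "cmod (1 - \<phi> x) = 1 - r"
      using norm_of_real[of "1 - r", where 'a = complex] r by simp
    finally have "v x * p (f x - g x) \<le> v x * (r * p (f x - g1 x) + (1 - r) * p (f x - g2 x))"
      using V_nonneg[OF vp(1)] by (rule mult_left_mono)
    then have le: "v x * p (f x - g x) \<le> r * ?e1 + (1 - r) * ?e2"
      by (simp add: algebra_simps)
    have e: "0 \<le> ?e1" "0 \<le> ?e2" "?e1 \<le> B" "?e2 \<le> B"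
      using B1(2)[of x] B2(2)[of x] V_nonneg[OF vp(1)] seminorm_nonneg[OF vp(2)]
      by (auto simp: B_def le_max_iff_disj)
    have e1: "?e1 \<le> c" if "t \<le> \<beta>"
      using c1(3)[of x] that x t by (auto simp: S1_def c_def)
    have e2: "?e2 \<le> c" if "\<alpha> \<le> t"
      using c2(3)[of x] that x t by (auto simp: S2_def c_def)
    \<comment> \<open>Below \<open>\<alpha>\<close> only \<open>g1\<close> is known to be good and
      \<open>1 - r\<close> is small; above \<open>\<beta>\<close> only \<open>g2\<close> is and
      \<open>r\<close> is small; in between both errors are at most \<open>c\<close>.\<close>
    consider "t < \<alpha>" | "\<alpha> \<le> t" "t \<le> \<beta>" | "\<beta> < t"
      by linarith
    then have "r * ?e1 + (1 - r) * ?e2 < d"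
    proof cases
      case 1
      then have "1 - r \<le> \<delta>"
        using bump(1)[of t] t by (simp add: r_def)
      then have "(1 - r) * ?e2 \<le> \<delta> * B" "r * ?e1 \<le> 1 * c"
        using e e1 1 r ab \<delta> by (intro mult_mono; simp)+
      then show ?thesis
        using \<delta> by simp
    next
      case 2
      then have "r * ?e1 + (1 - r) * ?e2 \<le> r * c + (1 - r) * c"
        using e1 e2 r by (intro add_mono mult_left_mono) auto
      then show ?thesis
        using cB by (simp add: algebra_simps)
    next
      case 3
      then have "r \<le> \<delta>"
        using bump(2)[of t] t by (simp add: r_def)
      then have "r * ?e1 \<le> \<delta> * B" "(1 - r) * ?e2 \<le> 1 * c"
        using e e2 3 r ab \<delta> by (intro mult_mono; simp)+
      then show ?thesis
        using \<delta> by simp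
    qed
    then show ?thesis
      using le by simp
  qed
  ultimately show ?thesis
    by blast
qed

lemma approximation_of_symmetric:
  assumes W0: "W0 \<subseteq> CV0 V P W" and f: "f \<in> CV0 V P W" and vp: "v \<in> V" "p \<in> P"
    and d: "0 < d" and A: "\<And>h. h \<in> A \<Longrightarrow> multiplier smul W0 h" "symmetric V A"
    and pointwise: "\<And>t \<epsilon>. 0 < \<epsilon> \<Longrightarrow> \<exists>g\<in>W0. p (f t - g t) < \<epsilon>"
  shows "\<exists>g\<in>W0. \<forall>x. v x * p (f x - g x) < d"
proof (rule ccontr)
  assume neg: "\<not> ?thesis"
  define E where "E = (\<lambda>g x. v x * p (f x - g x)) ` W0"
  have "compact {x. d \<le> e x}" if "e \<in> E" for e
  proof -
    obtain g where g: "g \<in> W0" "e = (\<lambda>x. v x * p (f x - g x))"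
      using \<open>e \<in> E\<close> unfolding E_def by blast
    then have "f - g \<in> CV0 V P W"
      using W0 f by (auto intro: CV0_diff)
    then show ?thesis
      using CV0_compact[of "f - g" v p d] vp d by (simp add: g(2))
  qed
  moreover have "\<exists>x. d \<le> e x" if "e \<in> E" for e
    using that neg by (auto simp: E_def not_less)
  ultimately obtain S where S: "closed S" "\<And>e. e \<in> E \<Longrightarrow> \<exists>x\<in>S. d \<le> e x"
      and min: "\<And>T. closed T \<Longrightarrow> T \<subset> S \<Longrightarrow> \<exists>e\<in>E. \<forall>x\<in>T. e x < d"
    using minimal_closed_set[of E d] by metis
  have bad: "\<exists>x\<in>S. d \<le> v x * p (f x - g x)" if "g \<in> W0" for g
    using S(2) that by (simp add: E_def)
  have good: "\<exists>g\<in>W0. \<forall>x\<in>T. v x * p (f x - g x) < d" if "closed T" "T \<subset> S" for T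
    using min[OF that] by (auto simp: E_def)
  \<comment> \<open>Off the support the weighted error is 0, so a failure on \<open>S\<close> must
    occur in \<open>S \<inter> support v\<close>; by minimality this cannot be a proper subset. The
    inclusion is what the weighted variant of symmetry asks for.\<close>
  have "S \<subseteq> support v"
  proof (rule ccontr)
    assume "\<not> S \<subseteq> support v"
    then obtain g where g: "g \<in> W0" "\<forall>x\<in>S \<inter> support v. v x * p (f x - g x) < d"
      using good[of "S \<inter> support v"] S(1) by (auto simp: support_def)
    obtain x where x: "x \<in> S" "d \<le> v x * p (f x - g x)"
      using bad g(1) by blast
    then have "x \<in> support v"
      using d closure_subset[of "{x. v x \<noteq> 0}"] by (auto simp: support_def)
    then show False
      using g(2) x by force
  qed
  moreover have "antisymmetric_set A S"
    unfolding antisymmetric_set_def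
  proof (intro ballI impI, rule ccontr)
    fix h assume h: "h \<in> A" "h ` S \<subseteq> complex_of_real ` {0..1}" and nc: "\<not> h constant_on S"
    have cont: "continuous_on UNIV (\<lambda>x. Re (h x))"
      using A(1)[OF h(1)] by (auto simp: multiplier_def intro!: continuous_intros)
    have real: "h x = complex_of_real (Re (h x))" "0 \<le> Re (h x)" "Re (h x) \<le> 1" if "x \<in> S" for x
    proof -
      have "h x \<in> complex_of_real ` {0..1}"
        using h(2) imageI[OF that] by (rule subsetD)
      then show "h x = complex_of_real (Re (h x))" "0 \<le> Re (h x)" "Re (h x) \<le> 1"
        by auto
    qed
    obtain y z where yz: "y \<in> S" "z \<in> S" "Re (h y) < Re (h z)"
      using nc unfolding constant_on_def by (metis real(1) linorder_neqE)
    \<comment> \<open>\<open>\<alpha>\<close> and \<open>\<beta>\<close> cut the interval from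
      \<open>Re (h y)\<close> to \<open>Re (h z)\<close> into thirds. Thus \<open>z\<close> is
      missing from the part below \<open>\<beta>\<close> and \<open>y\<close> from the part above
      \<open>\<alpha>\<close>, so both parts are proper and minimality applies to them.\<close>
    define \<alpha> where "\<alpha> = (2 * Re (h y) + Re (h z)) / 3"
    define \<beta> where "\<beta> = (Re (h y) + 2 * Re (h z)) / 3"
    have ab: "0 < \<alpha>" "\<alpha> < \<beta>" "\<beta> < 1" "Re (h y) < \<alpha>" "\<beta> < Re (h z)"
      using yz real[of y] real[of z] by (auto simp: \<alpha>_def \<beta>_def)
    have "closed (S \<inter> {x. Re (h x) \<le> \<beta>})" "closed (S \<inter> {x. \<alpha> \<le> Re (h x)})"
      using S(1) cont by (auto intro!: closed_Int closed_Collect_le continuous_intros)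
    moreover have "S \<inter> {x. Re (h x) \<le> \<beta>} \<subset> S" "S \<inter> {x. \<alpha> \<le> Re (h x)} \<subset> S"
      using yz ab by force+
    ultimately obtain g1 g2 where g: "g1 \<in> W0" "g2 \<in> W0"
        "\<forall>x\<in>S \<inter> {x. Re (h x) \<le> \<beta>}. v x * p (f x - g1 x) < d"
        "\<forall>x\<in>S \<inter> {x. \<alpha> \<le> Re (h x)}. v x * p (f x - g2 x) < d"
      using good by meson
    then have "\<exists>g\<in>W0. \<forall>x\<in>S. v x * p (f x - g x) < d"
      using separated_gluing[OF W0 f vp d A(1)[OF h(1)] S(1) h(2) ab(1-3), of g1 g2] by simp
    then show False
      using bad by (meson not_le)
  qed
  \<comment> \<open>Pointwise approximation supplies some element of \<open>W0\<close>, and its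
    failure on \<open>S\<close> supplies a point.\<close>
  moreover have "S \<noteq> {}"
    using bad pointwise[of 1] by force
  ultimately have "is_singleton S"
    using symmetric_antisymmetric_singleton A(2) vp(1) by blast
  then obtain t where t: "S = {t}"
    by (auto simp: is_singleton_def)
  have vt: "0 \<le> v t"
    using V_nonneg[OF vp(1)] .
  \<comment> \<open>Adding 1 keeps the denominator positive when \<open>v t = 0\<close>.\<close>
  obtain g where g: "g \<in> W0" "p (f t - g t) < d / (v t + 1)"
    using pointwise[of "d / (v t + 1)" t] d vt by auto
  have "v t * p (f t - g t) \<le> (v t + 1) * p (f t - g t)"
    using seminorm_nonneg[OF vp(2)] by (intro mult_right_mono) auto
  also have "\<dots> < d"
    using g(2) vt by (simp add: field_simps)
  finally show False
    using bad[OF g(1)] t by auto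
qed

end

text \<open>Positivity of some weight at each point makes evaluations continuous, and continuous
  maps send closures into closures. For the converse, the base condition replaces a neighbourhood of
  \<open>f\<close> by a single ball, where one weight and one seminorm have to be treated.\<close>

theorem corollary3p5:
  fixes smul :: "complex \<Rightarrow> 'b \<Rightarrow> 'b::ab_group_add"
    and P :: "('b \<Rightarrow> real) set"
    and V :: "('a::topological_space \<Rightarrow> real) set"
    and A :: "('a \<Rightarrow> complex) set"
    and W W0 :: "('a \<Rightarrow> 'b) set"
    and f :: "'a \<Rightarrow> 'b"
  assumes X: "vector_space smul" "\<forall>p\<in>P. seminorm smul p"
    and V: "nachbin_family V" "\<forall>t. \<exists>v\<in>V. 0 < v t"
    and W: "W \<subseteq> continuous_maps P" "module.subspace (\<lambda>c g t. smul c (g t)) W"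
    and base: "balls_local_base_at_0 V P W"
    and W0: "W0 \<subseteq> CV0 V P W"
    and A: "A \<noteq> {}" "A \<subseteq> {\<phi>. continuous_on UNIV \<phi>}"
      "\<forall>\<phi>\<in>A. multiplier smul W0 \<phi>" "symmetric V A"
    and f: "f \<in> CV0 V P W"
  shows "f \<in> weighted_topology V P W closure_of W0 \<longleftrightarrow>
    (\<forall>t. f t \<in> seminorm_topology P closure_of ((\<lambda>g. g t) ` W0))"
proof -
  interpret weighted_space smul P V W
  proof (rule weighted_space.intro[OF X(1)], unfold_locales)
    show "seminorm smul p" if "p \<in> P" for p
      using X(2) that by blast
  qed (fact V(1) W)+
  show ?thesis
  proof (intro iffI allI)
    fix t assume "f \<in> weighted_topology V P W closure_of W0"
    moreover have "(\<lambda>g. g t) ` (weighted_topology V P W closure_of W0)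
        \<subseteq> seminorm_topology P closure_of ((\<lambda>g. g t) ` W0)"
      using V(2) by (intro continuous_map_image_closure_subset continuous_map_evaluation) simp
    ultimately show "f t \<in> seminorm_topology P closure_of ((\<lambda>g. g t) ` W0)"
      by (rule subsetD[OF _ imageI, rotated])
  next
    assume pw: "\<forall>t. f t \<in> seminorm_topology P closure_of ((\<lambda>g. g t) ` W0)"
    show "f \<in> weighted_topology V P W closure_of W0"
      unfolding in_closure_of topspace_weighted
    proof (intro conjI f allI impI, elim conjE)
      fix U assume U: "f \<in> U" "openin (weighted_topology V P W) U"
      obtain v p \<epsilon> where vp: "v \<in> V" "p \<in> P" "0 < \<epsilon>" "weighted_ball V P W v p \<epsilon> f \<subseteq> U"
        using weighted_ball_neighbourhood[OF base f U(2,1)] by metis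
      have "\<exists>g\<in>W0. p (f t - g t) < r" if "0 < r" for t r
      proof -
        have "f t \<in> seminorm_topology P closure_of ((\<lambda>g. g t) ` W0)"
          using pw by (rule spec)
        moreover have "f t \<in> {y. p (y - f t) < r}"
          using that seminorm_0[OF vp(2)] by simp
        ultimately have "\<exists>y. y \<in> (\<lambda>g. g t) ` W0 \<and> y \<in> {y. p (y - f t) < r}"
          using openin_seminorm_ball[OF vp(2) that, of "f t"] unfolding in_closure_of by (meson conjI)
        then show ?thesis
          using seminorm_diff_commute[OF vp(2)] by auto
      qed
      \<comment> \<open>Half of \<open>\<epsilon>\<close>, because strict pointwise bounds give only
        a weak bound for the supremum.\<close>
      then obtain g where g: "g \<in> W0" "\<And>x. v x * p (f x - g x) < \<epsilon> / 2"
        using approximation_of_symmetric[OF W0 f vp(1,2), of "\<epsilon> / 2" A] A(3,4) vp(3) by auto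
      have "weighted_seminorm v p (g - f) \<le> \<epsilon> / 2"
        unfolding weighted_seminorm_def
        using g(2) seminorm_diff_commute[OF vp(2)] by (intro cSUP_least) (auto intro: less_imp_le)
      then have "g \<in> weighted_ball V P W v p \<epsilon> f"
        using g(1) W0 vp(3) by (auto simp: weighted_ball_def)
      then show "\<exists>g. g \<in> W0 \<and> g \<in> U"
        using g(1) vp(4) by blast
    qed
  qed
qed

end
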